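(* Let $R_1,\dots,R_k$ be commutative rings with identity. If $\Gamma(R_i)$ is not perfect for some $i$, then $\Gamma(R_1\times\cdots\times R_k)$ is not perfect.
   Context: For a commutative ring $R$ with identity, the zero-divisor graph $\Gamma(R)$ is the simple undirected graph whose vertices are the nonzero zero-divisors of $R$, two distinct vertices $u,v$ being adjacent iff $uv=0$. A graph is perfect if for every induced subgraph the chromatic number equals the clique number. *)

theory Defs
  imports "HOL-Algebra.Chinese_Remainder" "HOL-Library.Ramsey"
begin

unbundle cardinal_syntax

text \<open>A simple undirected graph is a pair of a vertex set and a set of two-element edges. It may be
  infinite, so chromatic and clique numbers are cardinals. A cardinal is represented, as in the
  library, by a cardinal order \<open>r\<close>, unique up to \<open>=o\<close>.\<close>

type_synonym 'v ugraph = "'v set \<times> 'v set set"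

abbreviation verts :: "'v ugraph \<Rightarrow> 'v set" where "verts \<equiv> fst"

abbreviation edges :: "'v ugraph \<Rightarrow> 'v set set" where "edges \<equiv> snd"

definition induced_subgraph :: "'v ugraph \<Rightarrow> 'v ugraph \<Rightarrow> bool" where
  "induced_subgraph H G \<longleftrightarrow> verts H \<subseteq> verts G \<and> edges H = {e \<in> edges G. e \<subseteq> verts H}"

definition proper_colouring :: "'v ugraph \<Rightarrow> ('v \<Rightarrow> 'c) \<Rightarrow> bool" where
  "proper_colouring G c \<longleftrightarrow>
     (\<forall>u\<in>verts G. \<forall>v\<in>verts G. {u, v} \<in> edges G \<longrightarrow> c u \<noteq> c v)"

text \<open>Taking colours from the vertex type is no restriction: a colouring by any other set can be
  renamed by sending each colour that is used to one vertex having that colour.\<close>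

definition is_chromatic_number :: "'v rel \<Rightarrow> 'v ugraph \<Rightarrow> bool" where
  "is_chromatic_number r G \<longleftrightarrow>
     (\<exists>c :: 'v \<Rightarrow> 'v. proper_colouring G c \<and> r =o |c ` verts G| ) \<and>
     (\<forall>c :: 'v \<Rightarrow> 'v. proper_colouring G c \<longrightarrow> r \<le>o |c ` verts G| )"

text \<open>The clique number is the supremum of the sizes of the cliques; it need not be attained if
  it is infinite. Cardinals on the vertex type suffice as competing upper bounds \<open>s\<close>, since \<open>|verts G|\<close> is
  one of them.\<close>

definition is_clique_number :: "'v rel \<Rightarrow> 'v ugraph \<Rightarrow> bool" where
  "is_clique_number r G \<longleftrightarrow>
     Card_order r \<and>
     (\<forall>K \<subseteq> verts G. clique K (edges G) \<longrightarrow> |K| \<le>o r) \<and>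
     (\<forall>s :: 'v rel. Card_order s \<and> (\<forall>K \<subseteq> verts G. clique K (edges G) \<longrightarrow> |K| \<le>o s)
        \<longrightarrow> r \<le>o s)"

lemma ex_chromatic_number:
  assumes "\<forall>e \<in> edges G. card e = 2"
  shows "\<exists>r. is_chromatic_number r G"
proof -
  let ?R = "{ |c ` verts G| | c :: 'a \<Rightarrow> 'a. proper_colouring G c}"
  have "proper_colouring G id"
    using assms by (auto simp: proper_colouring_def)
  then have "?R \<noteq> {}"
    by blast
  then have "\<exists>r\<in>?R. \<forall>r'\<in>?R. r \<le>o r'"
    by (intro exists_minim_Card_order) (auto simp: card_of_Card_order)
  then show ?thesis
    unfolding is_chromatic_number_def using card_of_refl by blast
qed

lemma chromatic_number_unique:
  "is_chromatic_number r G \<Longrightarrow> is_chromatic_number s G \<Longrightarrow> r =o s"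
  unfolding is_chromatic_number_def
  by (meson ordIso_iff_ordLeq ordIso_symmetric ordLeq_ordIso_trans)

lemma ex_clique_number: "\<exists>r. is_clique_number r G"
proof -
  let ?R = "{s :: 'a rel. Card_order s \<and> (\<forall>K \<subseteq> verts G. clique K (edges G) \<longrightarrow> |K| \<le>o s)}"
  have "|verts G| \<in> ?R"
    by (auto simp: card_of_Card_order card_of_mono1)
  then have "?R \<noteq> {}"
    by blast
  then have "\<exists>r\<in>?R. \<forall>r'\<in>?R. r \<le>o r'"
    by (intro exists_minim_Card_order) auto
  then show ?thesis
    unfolding is_clique_number_def by blast
qed

lemma clique_number_unique:
  "is_clique_number r G \<Longrightarrow> is_clique_number s G \<Longrightarrow> r =o s"
  unfolding is_clique_number_def by (simp add: ordIso_iff_ordLeq)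

definition perfect :: "'v ugraph \<Rightarrow> bool" where
  "perfect G \<longleftrightarrow>
     (\<forall>H. induced_subgraph H G \<longrightarrow> (\<exists>r. is_chromatic_number r H \<and> is_clique_number r H))"

definition nonzero_zero_divisors :: "('a, 'm) ring_scheme \<Rightarrow> 'a set" where
  "nonzero_zero_divisors R =
     {x \<in> carrier R - {\<zero>\<^bsub>R\<^esub>}. \<exists>y \<in> carrier R - {\<zero>\<^bsub>R\<^esub>}. x \<otimes>\<^bsub>R\<^esub> y = \<zero>\<^bsub>R\<^esub>}"

definition zero_divisor_graph :: "('a, 'm) ring_scheme \<Rightarrow> 'a ugraph" where
  "zero_divisor_graph R =
     (nonzero_zero_divisors R,
      {{u, v} | u v. u \<in> nonzero_zero_divisors R \<and> v \<in> nonzero_zero_divisors R \<and>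
                     u \<noteq> v \<and> u \<otimes>\<^bsub>R\<^esub> v = \<zero>\<^bsub>R\<^esub>})"

end

theory Submission
  imports Defs
begin

text \<open>Padding with zeros embeds \<open>R\<^sub>i\<close> into the product. It is multiplicative, injective and maps
  zero to zero, so it realises the zero-divisor graph of \<open>R\<^sub>i\<close> as an induced subgraph of that of the
  product, and perfection passes to induced subgraphs. The two graphs live on different types,
  so chromatic and clique numbers have to be transported along the embedding.\<close>

text \<open>The definition quantifies only over colourings by vertices. Replacing each colour in use
  by a chosen vertex of that colour turns \<open>c\<close> into such a colouring \<open>d\<close>.
  It stays proper because \<open>d u = d v\<close> forces \<open>c u = c v\<close>, and it uses no
  more colours because it factors through \<open>c\<close>.\<close>

lemma chromatic_number_ordLeq:
  fixes G :: "'v ugraph" and c :: "'v \<Rightarrow> 'c"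
  assumes r: "is_chromatic_number r G" and c: "proper_colouring G c"
  shows "r \<le>o |c ` verts G|"
proof -
  define d where "d = inv_into (verts G) c \<circ> c"
  have "c (d v) = c v" if "v \<in> verts G" for v
    using that by (simp add: d_def f_inv_into_f)
  then have "proper_colouring G d"
    using c unfolding proper_colouring_def by metis
  then have "r \<le>o |d ` verts G|"
    using r unfolding is_chromatic_number_def by blast
  moreover have "|d ` verts G| \<le>o |c ` verts G|"
    unfolding d_def image_comp[symmetric] by (rule card_of_image)
  ultimately show ?thesis
    by (rule ordLeq_transitive)
qed

text \<open>Optimal colourings pull back along \<open>f\<close> and along its inverse without
  changing the set of colours, which gives the two inequalities. A pulled-back colouring takes its
  colours in the vertex type of the other graph, which is why \<open>chromatic_number_ordLeq\<close>
  admits any colour type.\<close>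

lemma chromatic_number_iso:
  fixes G :: "'v ugraph" and H :: "'w ugraph"
  assumes f: "bij_betw f (verts G) (verts H)"
    and adj: "\<And>u v. \<lbrakk>u \<in> verts G; v \<in> verts G\<rbrakk> \<Longrightarrow> {f u, f v} \<in> edges H \<longleftrightarrow> {u, v} \<in> edges G"
    and r: "is_chromatic_number r G" and s: "is_chromatic_number s H"
  shows "r =o s"
proof -
  note img = bij_betw_imp_surj_on[OF f]
  define g where "g = inv_into (verts G) f"
  have g: "bij_betw g (verts H) (verts G)"
    unfolding g_def by (rule bij_betw_inv_into[OF f])
  have fg: "f (g w) = w" "g w \<in> verts G" if "w \<in> verts H" for w
    using that img unfolding g_def by (auto simp: f_inv_into_f inv_into_into)
  obtain c :: "'v \<Rightarrow> 'v" where c: "proper_colouring G c" "r =o |c ` verts G|"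
    using r unfolding is_chromatic_number_def by blast
  have "proper_colouring H (c \<circ> g)"
    using c(1) fg adj unfolding proper_colouring_def by (metis comp_apply)
  then have "s \<le>o |(c \<circ> g) ` verts H|"
    by (rule chromatic_number_ordLeq[OF s])
  then have 1: "s \<le>o r"
    using c(2) bij_betw_imp_surj_on[OF g]
    by (metis image_comp ordIso_symmetric ordLeq_ordIso_trans)
  obtain d :: "'w \<Rightarrow> 'w" where d: "proper_colouring H d" "s =o |d ` verts H|"
    using s unfolding is_chromatic_number_def by blast
  have "proper_colouring G (d \<circ> f)"
    using d(1) adj img unfolding proper_colouring_def by (metis comp_apply imageI)
  then have "r \<le>o |(d \<circ> f) ` verts G|"
    by (rule chromatic_number_ordLeq[OF r])
  then have 2: "r \<le>o s"
    using d(2) img by (metis image_comp ordIso_symmetric ordLeq_ordIso_trans)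
  from 1 2 show ?thesis
    by (simp add: ordIso_iff_ordLeq)
qed

text \<open>Along \<open>f\<close>, cliques correspond to cliques of the same size. A clique number
  is a cardinal order on the vertex type of its own graph, so \<open>r\<close> cannot in general
  serve for \<open>H\<close>; an equivalent \<open>s\<close> of the right type is taken as
  given.\<close>

lemma clique_number_iso:
  fixes G :: "'v ugraph" and H :: "'w ugraph"
  assumes f: "bij_betw f (verts G) (verts H)"
    and adj: "\<And>u v. \<lbrakk>u \<in> verts G; v \<in> verts G\<rbrakk> \<Longrightarrow> {f u, f v} \<in> edges H \<longleftrightarrow> {u, v} \<in> edges G"
    and r: "is_clique_number r G" and s: "Card_order s" "s =o r"
  shows "is_clique_number s H"
proof -
  note img = bij_betw_imp_surj_on[OF f] and inj = bij_betw_imp_inj_on[OF f]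
  have card_f: "|f ` K| =o |K|" if "K \<subseteq> verts G" for K
    using inj_on_subset[OF inj that]
    by (meson card_of_ordIso inj_on_imp_bij_betw ordIso_symmetric)
  \<comment> \<open>\<open>clique\<close> asks for edges between distinct members only, so
    injectivity of \<open>f\<close> is what matches the two conditions.\<close>
  have clique_f: "clique (f ` K) (edges H) \<longleftrightarrow> clique K (edges G)" if "K \<subseteq> verts G" for K
    using that adj inj unfolding clique_def by (auto simp: inj_on_def subset_iff) metis+
  have "|K| \<le>o s" if K: "K \<subseteq> verts H" "clique K (edges H)" for K
  proof -
    obtain L where L: "L \<subseteq> verts G" "K = f ` L"
      using K(1) img by (metis subset_imageE)
    then have "|L| \<le>o r"
      using r K(2) clique_f unfolding is_clique_number_def by blast
    then show ?thesis
      using card_f[OF L(1)] s(2) unfolding L(2)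
      by (meson ordIso_ordLeq_trans ordIso_symmetric ordLeq_ordIso_trans)
  qed
  moreover have "s \<le>o t"
    if t: "Card_order t" "\<forall>K \<subseteq> verts H. clique K (edges H) \<longrightarrow> |K| \<le>o t" for t :: "'w rel"
  proof -
    have bound: "|K| \<le>o t" if "K \<subseteq> verts G" "clique K (edges G)" for K
    proof -
      have "f ` K \<subseteq> verts H" "clique (f ` K) (edges H)"
        using that img clique_f by auto
      then have "|f ` K| \<le>o t"
        using t(2) by blast
      then show ?thesis
        using card_f[OF that(1)] by (meson ordIso_ordLeq_trans ordIso_symmetric)
    qed
    have "r \<le>o t"
    \<comment> \<open>Minimality of \<open>r\<close> cannot be applied to \<open>t\<close> directly.
      A small \<open>t\<close> has a copy \<open>|B|\<close> with \<open>B\<close> a set of vertices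
      of \<open>G\<close>; a large \<open>t\<close> lies above \<open>|verts G|\<close>, which
      bounds every clique of \<open>G\<close> and hence \<open>r\<close>.\<close>
    proof (cases "t \<le>o |verts G|")
      case True
      \<comment> \<open>Competing bounds for \<open>G\<close> must be cardinals on its own vertex type.\<close>
      then have "|Field t| \<le>o |verts G|"
        using card_of_Field_ordIso[OF t(1)] by (rule ordIso_ordLeq_trans[rotated])
      then obtain B where B: "B \<subseteq> verts G" "|Field t| =o |B|"
        using internalize_card_of_ordLeq2[of "Field t" "verts G"] by blast
      have tB: "t =o |B|"
        using card_of_Field_ordIso[OF t(1)] B(2) by (meson ordIso_symmetric ordIso_transitive)
      then have "\<forall>K \<subseteq> verts G. clique K (edges G) \<longrightarrow> |K| \<le>o |B|"
        using bound by (meson ordLeq_ordIso_trans)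
      then have "r \<le>o |B|"
        using r card_of_Card_order unfolding is_clique_number_def by blast
      then show ?thesis
        using tB by (meson ordIso_symmetric ordLeq_ordIso_trans)
    next
      case False
      then have "|verts G| \<le>o t"
        using t(1) by (meson card_of_Card_order card_order_on_well_order_on ordLeq_total)
      moreover have "r \<le>o |verts G|"
        using r card_of_Card_order card_of_mono1 unfolding is_clique_number_def by blast
      ultimately show ?thesis
        by (meson ordLeq_transitive)
    qed
    then show ?thesis
      using s(2) by (rule ordIso_ordLeq_trans[rotated])
  qed
  ultimately show ?thesis
    using s(1) unfolding is_clique_number_def by blast
qed

lemma perfect_if_embeds_in_perfect:
  fixes G :: "'v ugraph" and H :: "'w ugraph"
  assumes simple: "\<forall>e \<in> edges G. card e = 2"
    and inj: "inj_on f (verts G)" and into: "f ` verts G \<subseteq> verts H"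
    and adj: "\<And>u v. \<lbrakk>u \<in> verts G; v \<in> verts G\<rbrakk> \<Longrightarrow> {f u, f v} \<in> edges H \<longleftrightarrow> {u, v} \<in> edges G"
    and perf: "perfect H"
  shows "perfect G"
  unfolding perfect_def
proof (intro allI impI)
  fix G' assume G': "induced_subgraph G' G"
  define V where "V = verts G'"
  have V: "V \<subseteq> verts G" "edges G' = {e \<in> edges G. e \<subseteq> V}"
    using G' by (auto simp: induced_subgraph_def V_def)
  define H' where "H' = (f ` V, {e \<in> edges H. e \<subseteq> f ` V})"
  have "induced_subgraph H' H"
    using V(1) into by (auto simp: induced_subgraph_def H'_def)
  then obtain r where r: "is_chromatic_number r H'" "is_clique_number r H'"
    using perf unfolding perfect_def by blast
  \<comment> \<open>This supplies a cardinal on the right type. Edges with two elements ensure that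
    a proper colouring exists at all. Since \<open>s\<close> turns out equivalent to
    \<open>r\<close>, it will serve as the clique number too.\<close>
  obtain s where s: "is_chromatic_number s G'"
    using ex_chromatic_number[of G'] simple V(2) by auto
  have f: "bij_betw f (verts G') (verts H')"
    using inj_on_subset[OF inj V(1)] by (simp add: H'_def V_def bij_betw_def)
  have adj': "{f u, f v} \<in> edges H' \<longleftrightarrow> {u, v} \<in> edges G'"
    if "u \<in> verts G'" "v \<in> verts G'" for u v
    using that adj[of u v] V by (auto simp: H'_def V_def)
  have sr: "s =o r"
    using chromatic_number_iso[OF f adj' s r(1)] by simp
  \<comment> \<open>The clique number is known for \<open>H'\<close>, so it is transported in the
    direction of the inverse.\<close>
  let ?g = "inv_into (verts G') f"
  have g: "bij_betw ?g (verts H') (verts G')"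
    by (rule bij_betw_inv_into[OF f])
  have adj_g: "{?g u, ?g v} \<in> edges G' \<longleftrightarrow> {u, v} \<in> edges H'"
    if "u \<in> verts H'" "v \<in> verts H'" for u v
    using that adj'[of "?g u" "?g v"] bij_betw_inv_into_right[OF f] bij_betw_apply[OF g]
    by auto
  have "Card_order s"
    using s card_of_Card_order Card_order_ordIso unfolding is_chromatic_number_def by blast
  then have "is_clique_number s G'"
    using clique_number_iso[OF g adj_g r(2) _ sr] by simp
  with s show "\<exists>r. is_chromatic_number r G' \<and> is_clique_number r G'"
    by blast
qed

text \<open>The edge \<open>{u, v}\<close> is unordered while the multiplication of an arbitrary
  \<open>R\<close> need not commute, hence the disjunction.\<close>

lemma zero_divisor_graph_edge_iff:
  "{u, v} \<in> edges (zero_divisor_graph R) \<longleftrightarrow>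
     u \<in> nonzero_zero_divisors R \<and> v \<in> nonzero_zero_divisors R \<and> u \<noteq> v \<and>
     (u \<otimes>\<^bsub>R\<^esub> v = \<zero>\<^bsub>R\<^esub> \<or> v \<otimes>\<^bsub>R\<^esub> u = \<zero>\<^bsub>R\<^esub>)"
  by (auto simp: zero_divisor_graph_def doubleton_eq_iff)

lemma perfect_zero_divisor_graph_if_embeds:
  assumes f: "f \<in> carrier R \<rightarrow> carrier S" and inj: "inj_on f (carrier R)"
    and R: "ring R" and zero: "f \<zero>\<^bsub>R\<^esub> = \<zero>\<^bsub>S\<^esub>"
    and mult: "\<And>x y. \<lbrakk>x \<in> carrier R; y \<in> carrier R\<rbrakk> \<Longrightarrow> f (x \<otimes>\<^bsub>R\<^esub> y) = f x \<otimes>\<^bsub>S\<^esub> f y"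
    and perf: "perfect (zero_divisor_graph S)"
  shows "perfect (zero_divisor_graph R)"
proof (rule perfect_if_embeds_in_perfect[where f = f, OF _ _ _ _ perf])
  interpret ring R by (rule R)
  have eq_iff: "f x = f y \<longleftrightarrow> x = y" if "x \<in> carrier R" "y \<in> carrier R" for x y
    using inj that by (auto simp: inj_on_def)
  have zero_iff: "f x = \<zero>\<^bsub>S\<^esub> \<longleftrightarrow> x = \<zero>\<^bsub>R\<^esub>" if "x \<in> carrier R" for x
    using eq_iff[OF that zero_closed] zero by simp
  have mult_zero_iff: "f x \<otimes>\<^bsub>S\<^esub> f y = \<zero>\<^bsub>S\<^esub> \<longleftrightarrow> x \<otimes>\<^bsub>R\<^esub> y = \<zero>\<^bsub>R\<^esub>"
    if "x \<in> carrier R" "y \<in> carrier R" for x y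
    using that by (simp flip: mult zero_iff)
  have carr: "x \<in> carrier R" if "x \<in> nonzero_zero_divisors R" for x
    using that by (simp add: nonzero_zero_divisors_def)
  have nzd: "f x \<in> nonzero_zero_divisors S" if x: "x \<in> nonzero_zero_divisors R" for x
  proof -
    obtain y where y: "y \<in> carrier R" "y \<noteq> \<zero>\<^bsub>R\<^esub>" "x \<otimes>\<^bsub>R\<^esub> y = \<zero>\<^bsub>R\<^esub>"
      and "x \<in> carrier R" "x \<noteq> \<zero>\<^bsub>R\<^esub>"
      using x by (auto simp: nonzero_zero_divisors_def)
    then have "f x \<in> carrier S - {\<zero>\<^bsub>S\<^esub>}" "f y \<in> carrier S - {\<zero>\<^bsub>S\<^esub>}"
      "f x \<otimes>\<^bsub>S\<^esub> f y = \<zero>\<^bsub>S\<^esub>"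
      using f by (auto simp: zero_iff mult_zero_iff)
    then show ?thesis
      unfolding nonzero_zero_divisors_def by blast
  qed
  show "\<forall>e \<in> edges (zero_divisor_graph R). card e = 2"
    by (auto simp: zero_divisor_graph_def)
  show "inj_on f (verts (zero_divisor_graph R))"
    using carr by (auto simp: zero_divisor_graph_def intro: inj_on_subset[OF inj])
  show "f ` verts (zero_divisor_graph R) \<subseteq> verts (zero_divisor_graph S)"
    using nzd by (auto simp: zero_divisor_graph_def)
  show "{f u, f v} \<in> edges (zero_divisor_graph S) \<longleftrightarrow> {u, v} \<in> edges (zero_divisor_graph R)"
    if "u \<in> verts (zero_divisor_graph R)" "v \<in> verts (zero_divisor_graph R)" for u v
  proof -
    have "u \<in> nonzero_zero_divisors R" "v \<in> nonzero_zero_divisors R"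
      using that by (simp_all add: zero_divisor_graph_def)
    then show ?thesis
      by (simp add: zero_divisor_graph_edge_iff nzd carr eq_iff mult_zero_iff)
  qed
qed

lemma RDirProd_list_nth_zero:
  "i < length Rs \<Longrightarrow> \<zero>\<^bsub>RDirProd_list Rs\<^esub> ! i = \<zero>\<^bsub>Rs ! i\<^esub>"
proof (induction Rs arbitrary: i)
  case (Cons R Rs)
  then show ?case
    by (cases i) (simp_all add: RDirProd_list_zero')
qed simp

lemma RDirProd_list_nth_mult:
  assumes "xs \<in> carrier (RDirProd_list Rs)" "ys \<in> carrier (RDirProd_list Rs)" "i < length Rs"
  shows "(xs \<otimes>\<^bsub>RDirProd_list Rs\<^esub> ys) ! i = xs ! i \<otimes>\<^bsub>Rs ! i\<^esub> ys ! i"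
  using assms
proof (induction Rs arbitrary: xs ys i)
  case (Cons R Rs)
  obtain x xs' y ys' where xy: "xs = x # xs'" "ys = y # ys'" "x \<in> carrier R" "y \<in> carrier R"
    "xs' \<in> carrier (RDirProd_list Rs)" "ys' \<in> carrier (RDirProd_list Rs)"
    using Cons.prems(1,2) unfolding RDirProd_list_carrier by auto
  \<comment> \<open>The product of a list is built from binary products, and consing is a
    homomorphism from \<open>RDirProd R (RDirProd_list Rs)\<close>; this splits the multiplication
    into head and tail.\<close>
  then have "xs \<otimes>\<^bsub>RDirProd_list (R # Rs)\<^esub> ys = (x \<otimes>\<^bsub>R\<^esub> y) # (xs' \<otimes>\<^bsub>RDirProd_list Rs\<^esub> ys')"
    using ring_hom_mult[OF RDirProd_list_hom1, of "(x, xs')" R Rs "(y, ys')"]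
    by (simp add: RDirProd_carrier) (simp add: RDirProd_def DirProd_def monoid.defs)
  then show ?case
    using Cons.IH[OF xy(5,6)] Cons.prems(3) xy(1,2) by (cases i) auto
qed simp

lemma perfect_zero_divisor_graph_factor:
  assumes rings: "\<And>j. j < length Rs \<Longrightarrow> ring (Rs ! j)" and i: "i < length Rs"
    and perf: "perfect (zero_divisor_graph (RDirProd_list Rs))"
  shows "perfect (zero_divisor_graph (Rs ! i))"
proof -
  let ?P = "RDirProd_list Rs"
  interpret P: ring ?P
    using rings by (rule RDirProd_list_is_ring)
  note len = RDirProd_list_carrier_mem(1)
  have len_zero: "length \<zero>\<^bsub>?P\<^esub> = length Rs"
    by (rule len[OF P.zero_closed])
  \<comment> \<open>The padding map: the zero of the product with its entry at position
    \<open>i\<close> replaced by \<open>x\<close>.\<close>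
  define f where "f x = \<zero>\<^bsub>?P\<^esub>[i := x]" for x
  have nth_f: "f x ! j = (if j = i then x else \<zero>\<^bsub>Rs ! j\<^esub>)" if "j < length Rs" for x j
    using that len_zero by (simp add: f_def nth_list_update RDirProd_list_nth_zero)
  have len_f: "length (f x) = length Rs" for x
    by (simp add: f_def len_zero)
  have f_carr: "f x \<in> carrier ?P" if "x \<in> carrier (Rs ! i)" for x
    using that rings
    by (intro RDirProd_list_carrier_memI) (auto simp: len_f nth_f ring.ring_simprules(2))
  show ?thesis
  proof (rule perfect_zero_divisor_graph_if_embeds[where f = f, OF _ _ rings[OF i] _ _ perf])
    show "f \<in> carrier (Rs ! i) \<rightarrow> carrier ?P"
      using f_carr by blast
    show "inj_on f (carrier (Rs ! i))"
      using nth_f[OF i] by (metis inj_onI)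
    show "f \<zero>\<^bsub>Rs ! i\<^esub> = \<zero>\<^bsub>?P\<^esub>"
      using RDirProd_list_nth_zero[OF i] by (metis f_def list_update_id)
    show "f (x \<otimes>\<^bsub>Rs ! i\<^esub> y) = f x \<otimes>\<^bsub>?P\<^esub> f y"
      if "x \<in> carrier (Rs ! i)" "y \<in> carrier (Rs ! i)" for x y
    proof (rule nth_equalityI)
      show "length (f (x \<otimes>\<^bsub>Rs ! i\<^esub> y)) = length (f x \<otimes>\<^bsub>?P\<^esub> f y)"
        using len[OF P.m_closed[OF f_carr f_carr]] that by (simp add: len_f)
      fix j assume "j < length (f (x \<otimes>\<^bsub>Rs ! i\<^esub> y))"
      then have j: "j < length Rs"
        by (simp add: len_f)
      \<comment> \<open>Away from position \<open>i\<close> both factors have entry zero, so the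
        claim there is that zero times zero is zero in \<open>Rs ! j\<close>.\<close>
      interpret Rj: ring "Rs ! j"
        by (rule rings[OF j])
      show "f (x \<otimes>\<^bsub>Rs ! i\<^esub> y) ! j = (f x \<otimes>\<^bsub>?P\<^esub> f y) ! j"
        using j that by (simp add: RDirProd_list_nth_mult f_carr nth_f)
    qed
  qed
qed

theorem theorem3p4:
  fixes Rs :: "('a, 'm) ring_scheme list"
  assumes "\<forall>i < length Rs. cring (Rs ! i)"
    and "\<exists>i < length Rs. \<not> perfect (zero_divisor_graph (Rs ! i))"
  shows "\<not> perfect (zero_divisor_graph (RDirProd_list Rs))"
  using assms perfect_zero_divisor_graph_factor cring.axioms(1) by blast

end
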